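(* Let $0\le\underline{k}\le\overline{k}$ be integers. As formal Laurent series in $x$ with coefficients in $\mathbb{Z}[y,z]$, $$\sum_{n,m,r}w_{\underline{k}\le\overline{k}}(n,m,r)\,x^ny^mz^r=\frac{1-xz}{x\Big(1-x(z+1)+(1-y)\big(x^{\underline{k}+1}z^{\underline{k}}-x^{\overline{k}+2}z^{\overline{k}+1}\big)\Big)}.$$
   Context: An $n$-string is a binary string of length $n$; its Hamming weight is its number of ones. A run of ones is a maximal block of consecutive ones, flanked on each side by a zero or by the start/end of the string. Null runs (length $0$) of ones also count: there is one between every two consecutive zeros, one before an initial zero and one after a final zero; thus a string with $j$ zeros has exactly $j+1$ runs of ones (including null ones); the empty string has one null run. For $n\ge 0$, $w_{\underline{k}\le\overline{k}}(n,m,r)$ is the number of $n$-strings of Hamming weight $r$ containing exactly $m$ runs of ones whose length lies in $[\underline{k},\overline{k}]$ (null runs included if $\underline{k}=0$; other runs unrestricted). By convention $w_{\underline{k}\le\overline{k}}(-1,m,r)=1$ if $m=r=0$ and $0$ otherwise, and the quantity is $0$ if $n<-1$, $m<0$ or $r<0$. The sum is over all integers $n,m,r$. *)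

theory Defs
  imports
    "HOL-Computational_Algebra.Formal_Laurent_Series"
    "HOL-Computational_Algebra.Polynomial"
    "HOL-Library.Groups_Big_Fun"
begin

text \<open>
  A binary string is a \<^typ>\<open>bool list\<close>, with \<^term>\<open>True\<close> for one. The run of ones
  \<open>s ! i, \<dots>, s ! (j - 1)\<close> is represented by the pair \<open>(i, j)\<close> and has length \<open>j - i\<close>. Each end
  must be flanked by a zero or by an end of the string. For \<open>i = j\<close> this describes exactly the
  null runs: the gaps between two consecutive zeros, before an initial zero and after a final
  zero, and the single gap of the empty string.
\<close>

definition runs_of_ones :: "bool list \<Rightarrow> (nat \<times> nat) set" where
  "runs_of_ones s =
     {(i, j). i \<le> j \<and> j \<le> length s \<and> (\<forall>l. i \<le> l \<and> l < j \<longrightarrow> s ! l)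
        \<and> (i = 0 \<or> \<not> s ! (i - 1)) \<and> (j = length s \<or> \<not> s ! j)}"

definition hamming_weight :: "bool list \<Rightarrow> nat" where
  "hamming_weight s = count_list s True"

definition num_runs :: "nat \<Rightarrow> nat \<Rightarrow> bool list \<Rightarrow> nat" where
  "num_runs kmin kmax s =
     card {(i, j) \<in> runs_of_ones s. kmin \<le> j - i \<and> j - i \<le> kmax}"

definition w :: "nat \<Rightarrow> nat \<Rightarrow> int \<Rightarrow> int \<Rightarrow> int \<Rightarrow> nat" where
  "w kmin kmax n m r =
     (if n < -1 \<or> m < 0 \<or> r < 0 then 0
      else if n = -1 then (if m = 0 \<and> r = 0 then 1 else 0)
      else card {s. int (length s) = n \<and> int (hamming_weight s) = r
                    \<and> int (num_runs kmin kmax s) = m})"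

text \<open>
  The coefficient ring of integer polynomials in \<open>y\<close> and \<open>z\<close> is \<^typ>\<open>int poly poly\<close>, with \<open>y\<close>
  as the outer and \<open>z\<close> as the inner variable.
\<close>

definition Y :: "int poly poly" where
  "Y = [:0, 1:]"

definition Z :: "int poly poly" where
  "Z = [:[:0, 1:]:]"

text \<open>
  \<^const>\<open>Sum_any\<close>, written as a sum without index set, and \<^const>\<open>Abs_fls\<close> are only meaningful for
  finitely many nonzero terms and for coefficients that vanish far to the left, respectively;
  lemmas \<open>finite_w_support\<close> and \<open>gen_fun_nth\<close> below show that this is the case here. Exponents
  \<open>nat m\<close>, \<open>nat r\<close> are harmless because \<^const>\<open>w\<close> vanishes for negative \<open>m\<close> or \<open>r\<close>.
\<close>

definition gen_fun_coeff :: "nat \<Rightarrow> nat \<Rightarrow> int \<Rightarrow> int poly poly" where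
  "gen_fun_coeff kmin kmax n =
     (\<Sum>(m, r). of_nat (w kmin kmax n m r) * Y ^ nat m * Z ^ nat r)"

definition gen_fun :: "nat \<Rightarrow> nat \<Rightarrow> int poly poly fls" where
  "gen_fun kmin kmax = Abs_fls (gen_fun_coeff kmin kmax)"

lemma finite_w_support: "finite {(m, r). w kmin kmax n m r \<noteq> 0}"
proof (rule finite_subset)
  show "{(m, r). w kmin kmax n m r \<noteq> 0} \<subseteq> {0..(n + 1) * (n + 1)} \<times> {0..n + 1}"
  proof (rule subrelI)
    fix m r assume "(m, r) \<in> {(m, r). w kmin kmax n m r \<noteq> 0}"
    then have nz: "w kmin kmax n m r \<noteq> 0" by simp
    then have ge: "n \<ge> -1" "m \<ge> 0" "r \<ge> 0"
      by (auto simp: w_def split: if_splits)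
    show "(m, r) \<in> {0..(n + 1) * (n + 1)} \<times> {0..n + 1}"
    proof (cases "n = -1")
      case True
      with nz show ?thesis by (auto simp: w_def split: if_splits)
    next
      case False
      with nz ge have "{s. int (length s) = n \<and> int (hamming_weight s) = r
                    \<and> int (num_runs kmin kmax s) = m} \<noteq> {}"
        by (auto simp: w_def simp del: Collect_empty_eq split: if_splits)
      then obtain s where s: "int (length s) = n" "int (hamming_weight s) = r"
        "int (num_runs kmin kmax s) = m" by blast
      have "hamming_weight s \<le> length s"
        by (simp add: hamming_weight_def count_le_length)
      moreover have "num_runs kmin kmax s \<le> card ({0..length s} \<times> {0..length s})"
        unfolding num_runs_def by (rule card_mono) (auto simp: runs_of_ones_def)
      then have "num_runs kmin kmax s \<le> (length s + 1) * (length s + 1)"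
        by simp
      then have "int (num_runs kmin kmax s) \<le> int ((length s + 1) * (length s + 1))"
        by (simp only: of_nat_le_iff)
      moreover have "int ((length s + 1) * (length s + 1)) = (n + 1) * (n + 1)"
        by (simp add: algebra_simps flip: s(1))
      ultimately show ?thesis using s ge by simp
    qed
  qed
qed simp

lemma gen_fun_nth: "fls_nth (gen_fun kmin kmax) n = gen_fun_coeff kmin kmax n"
proof -
  have "\<forall>n < -1. gen_fun_coeff kmin kmax n = 0"
    by (simp add: gen_fun_coeff_def w_def)
  then show ?thesis
    unfolding gen_fun_def by (rule nth_Abs_fls_lower_bound)
qed

lemma card_runs_of_ones: "card (runs_of_ones s) = count_list s False + 1"
proof -
  have bij: "bij_betw fst (runs_of_ones s) (insert 0 (Suc ` {l. l < length s \<and> \<not> s ! l}))"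
    unfolding bij_betw_def
  proof
    show "inj_on fst (runs_of_ones s)"
    proof (rule inj_onI, clarsimp)
      fix i j j' assume a: "(i, j) \<in> runs_of_ones s" "(i, j') \<in> runs_of_ones s"
      have "\<not> j < j'" "\<not> j' < j"
        using a by (auto simp: runs_of_ones_def)
      then show "j = j'" by simp
    qed
    show "fst ` runs_of_ones s = insert 0 (Suc ` {l. l < length s \<and> \<not> s ! l})"
    proof (intro equalityI subsetI)
      fix i assume "i \<in> fst ` runs_of_ones s"
      then obtain j where "(i, j) \<in> runs_of_ones s" by auto
      then show "i \<in> insert 0 (Suc ` {l. l < length s \<and> \<not> s ! l})"
        by (cases i) (auto simp: runs_of_ones_def)
    next
      fix i assume i: "i \<in> insert 0 (Suc ` {l. l < length s \<and> \<not> s ! l})"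
      define P where "P = (\<lambda>j. i \<le> j \<and> (j = length s \<or> \<not> s ! j))"
      define j where "j = (LEAST j. P j)"
      have len: "P (length s)" using i by (auto simp: P_def)
      have "P j" unfolding j_def by (rule LeastI[of P, OF len])
      moreover have "j \<le> length s" unfolding j_def by (rule Least_le[of P, OF len])
      moreover have "\<And>l. l < j \<Longrightarrow> \<not> P l" unfolding j_def by (rule not_less_Least)
      ultimately have "(i, j) \<in> runs_of_ones s"
        using i by (auto simp: runs_of_ones_def P_def)
      then show "i \<in> fst ` runs_of_ones s" by force
    qed
  qed
  have "card (runs_of_ones s) = Suc (card {l. l < length s \<and> \<not> s ! l})"
    unfolding bij_betw_same_card[OF bij] by (subst card_insert_disjoint) (auto simp: card_image)
  also have "card {l. l < length s \<and> \<not> s ! l} = length (filter (\<lambda>b. \<not> b) s)"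
    by (simp add: length_filter_conv_card)
  also have "\<dots> = count_list s False"
    by (induction s) auto
  finally show ?thesis by simp
qed

text \<open>
  The coefficient ring is not a field, so a fraction \<open>a / b\<close> of Laurent series over it stands for
  the unique \<open>q\<close> with \<open>q * b = a\<close>, where \<open>b\<close> is a unit (\<open>b dvd 1\<close>).
\<close>

definition is_fraction :: "'a::comm_ring_1 \<Rightarrow> 'a \<Rightarrow> 'a \<Rightarrow> bool" where
  "is_fraction q a b \<longleftrightarrow> b dvd 1 \<and> q * b = a"

end

theory Submission
  imports Defs
begin

text \<open>
  Append a virtual zero to a string of length \<open>n \<ge> 0\<close>. The result is, uniquely, a nonempty sequence
  of blocks \<open>1\<^sup>l0\<close>, and its blocks correspond to the runs of ones of the string, null runs
  included. A block \<open>1\<^sup>l0\<close> contributes \<open>x\<^bsup>l+1\<^esup> z\<^sup>l c\<^sub>l\<close>, where \<open>c\<^sub>l\<close> is \<open>y\<close> if \<open>l\<close> lies in the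
  prescribed interval and \<open>1\<close> otherwise. The term at \<open>n = -1\<close> is the empty sequence of blocks. So,
  with \<open>C = (\<Sum>l. c\<^sub>l z\<^sup>l x\<^sup>l)\<close>, the generating function shifted by \<open>x\<close> is the power series
  \<open>A = 1 / (1 - x C)\<close>. Splitting off the first block gives this in the form \<open>A = 1 + x C A\<close>
  (\<open>string_fps_eq\<close>).

  Since \<open>C\<close> is the geometric series \<open>1 / (1 - x z)\<close> minus \<open>1 - y\<close> times the part of it
  between the two bounds, \<open>(1 - x z) C\<close> is a polynomial (\<open>block_fps_closed_form\<close>), and multiplying
  \<open>A (1 - x C) = 1\<close> by \<open>1 - x z\<close> gives the closed form.
\<close>

section \<open>Splitting off the first block of a string\<close>

lemma runs_of_ones_replicate: "runs_of_ones (replicate n True) = {(0, n)}"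
  by (auto simp: runs_of_ones_def)

lemma runs_of_ones_block:
  "runs_of_ones (replicate l True @ False # s) =
     insert (0, l) ((\<lambda>(i, j). (i + Suc l, j + Suc l)) ` runs_of_ones s)"
    (is "?L = insert _ (?f ` _)")
proof (intro equalityI subsetI)
  fix p assume p: "p \<in> ?L"
  obtain i j where ij: "p = (i, j)" by (cases p)
  have le: "i \<le> j" "j \<le> l + Suc (length s)"
    and ones: "\<And>q. i \<le> q \<Longrightarrow> q < j \<Longrightarrow> (replicate l True @ False # s) ! q"
    and left: "i = 0 \<or> \<not> (replicate l True @ False # s) ! (i - 1)"
    and right: "j = l + Suc (length s) \<or> \<not> (replicate l True @ False # s) ! j"
    using p by (auto simp: ij runs_of_ones_def)
  \<comment> \<open>No run contains the zero at position \<open>l\<close>, so a run ends before it or starts after it.\<close>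
  have "\<not> (i \<le> l \<and> l < j)"
    using ones[of l] by (auto simp: nth_append)
  then consider "j \<le> l" | "l < i" by linarith
  then show "p \<in> insert (0, l) (?f ` runs_of_ones s)"
  proof cases
    case 1
    then have "j = l" using right by (auto simp: nth_append split: if_splits)
    moreover have "i = 0" using left le 1 by (auto simp: nth_append split: if_splits)
    ultimately show ?thesis by (simp add: ij)
  next
    case 2
    have "(i - Suc l, j - Suc l) \<in> runs_of_ones s"
      unfolding runs_of_ones_def mem_Collect_eq prod.case
    proof (intro conjI allI impI)
      show "s ! q" if "i - Suc l \<le> q \<and> q < j - Suc l" for q
        using ones[of "q + Suc l"] that by (auto simp: nth_append)
      show "i - Suc l = 0 \<or> \<not> s ! (i - Suc l - 1)"
        using left 2 by (cases "i = Suc l") (auto simp: nth_append nth_Cons' split: if_splits)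
      show "j - Suc l = length s \<or> \<not> s ! (j - Suc l)"
        using right le 2 by (auto simp: nth_append nth_Cons' split: if_splits)
    qed (use le in auto)
    then show ?thesis
      using 2 le by (force simp: ij image_iff intro!: bexI[of _ "(i - Suc l, j - Suc l)"])
  qed
next
  fix p assume "p \<in> insert (0, l) (?f ` runs_of_ones s)"
  then consider "p = (0, l)"
    | i j where "(i, j) \<in> runs_of_ones s" "p = (i + Suc l, j + Suc l)" by auto
  then show "p \<in> ?L"
  proof cases
    case 1
    then show ?thesis by (auto simp: runs_of_ones_def nth_append)
  next
    case 2
    have "(replicate l True @ False # s) ! q"
      if "i + Suc l \<le> q" "q < j + Suc l" for q
    proof -
      have "i \<le> q - Suc l" "q - Suc l < j"
        using that by linarith+
      then have "s ! (q - Suc l)"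
        using 2(1) by (auto simp: runs_of_ones_def)
      with that show ?thesis by (auto simp: nth_append nth_Cons')
    qed
    with 2 show ?thesis
      by (cases i) (auto simp: runs_of_ones_def nth_append)
  qed
qed

lemma finite_runs_of_ones: "finite (runs_of_ones s)"
  by (rule finite_subset[of _ "{..length s} \<times> {..length s}"]) (auto simp: runs_of_ones_def)

lemma num_runs_replicate:
  "num_runs kmin kmax (replicate n True) = of_bool (kmin \<le> n \<and> n \<le> kmax)"
proof -
  have "{(i, j) \<in> runs_of_ones (replicate n True). kmin \<le> j - i \<and> j - i \<le> kmax} =
    (if kmin \<le> n \<and> n \<le> kmax then {(0, n)} else {})"
    by (auto simp: runs_of_ones_replicate)
  then show ?thesis unfolding num_runs_def by simp
qed

lemma num_runs_block:
  "num_runs kmin kmax (replicate l True @ False # s) =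
     of_bool (kmin \<le> l \<and> l \<le> kmax) + num_runs kmin kmax s"
proof -
  define f where "f = (\<lambda>(i, j). (i + Suc l, j + Suc l))"
  define B where "B = (if kmin \<le> l \<and> l \<le> kmax then {(0::nat, l)} else {})"
  define R where "R = {(i, j) \<in> runs_of_ones s. kmin \<le> j - i \<and> j - i \<le> kmax}"
  have "{(i, j) \<in> runs_of_ones (replicate l True @ False # s). kmin \<le> j - i \<and> j - i \<le> kmax}
      = B \<union> f ` R"
    unfolding runs_of_ones_block B_def R_def f_def by auto
  then have "num_runs kmin kmax (replicate l True @ False # s) = card (B \<union> f ` R)"
    by (simp add: num_runs_def)
  also have "\<dots> = card B + card (f ` R)"
    by (rule card_Un_disjoint)
      (auto simp: B_def R_def f_def intro: finite_subset[OF _ finite_runs_of_ones[of s]])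
  also have "card (f ` R) = card R"
    by (rule card_image) (auto simp: f_def inj_on_def)
  also have "card B = of_bool (kmin \<le> l \<and> l \<le> kmax)"
    by (simp add: B_def)
  finally show ?thesis by (simp add: num_runs_def R_def)
qed

section \<open>Weighted enumeration of strings\<close>

definition string_weight :: "nat \<Rightarrow> nat \<Rightarrow> bool list \<Rightarrow> int poly poly" where
  "string_weight kmin kmax s = Y ^ num_runs kmin kmax s * Z ^ hamming_weight s"

definition run_weight :: "nat \<Rightarrow> nat \<Rightarrow> nat \<Rightarrow> int poly poly" where
  "run_weight kmin kmax l = (if kmin \<le> l \<and> l \<le> kmax then Y else 1) * Z ^ l"

lemma hamming_weight_replicate_append:
  "hamming_weight (replicate l True @ s) = l + hamming_weight s"
  by (induction l) (simp_all add: hamming_weight_def)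

lemma string_weight_replicate:
  "string_weight kmin kmax (replicate n True) = run_weight kmin kmax n"
  using hamming_weight_replicate_append[of n "[]"]
  by (simp add: string_weight_def run_weight_def num_runs_replicate hamming_weight_def)

lemma string_weight_block:
  "string_weight kmin kmax (replicate l True @ False # s) =
     run_weight kmin kmax l * string_weight kmin kmax s"
  unfolding string_weight_def num_runs_block hamming_weight_replicate_append
  by (simp add: run_weight_def hamming_weight_def power_add)

definition string_sum :: "nat \<Rightarrow> nat \<Rightarrow> nat \<Rightarrow> int poly poly" where
  "string_sum kmin kmax n = (\<Sum>s | length s = n. string_weight kmin kmax s)"

lemma finite_strings: "finite {s :: bool list. length s = n}"
  using finite_lists_length_eq[of "UNIV :: bool set" n] by simp

lemma sum_strings_Suc:
  "(\<Sum>s | length s = Suc n. f s) =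
     (\<Sum>s | length s = n. f (True # s)) + (\<Sum>s | length s = n. f (False # s))"
  for f :: "bool list \<Rightarrow> 'a::comm_monoid_add"
proof -
  have split: "{s :: bool list. length s = Suc n} =
      Cons True ` {s. length s = n} \<union> Cons False ` {s. length s = n}"
    by (auto simp: length_Suc_conv)
  show ?thesis
    unfolding split by (subst sum.union_disjoint) (auto simp: finite_strings sum.reindex)
qed

text \<open>
  The prefix \<open>1\<^sup>l\<close> is the part of the first block already read; letting it vary is what allows
  induction on \<open>n\<close>. If the next symbol is a one the prefix grows, and if it is a zero the first
  block is complete. The term outside the sum is the string of ones only, whose first block is
  closed by the virtual zero.
\<close>

lemma sum_strings_prefix:
  "(\<Sum>s | length s = n. string_weight kmin kmax (replicate l True @ s)) =
     run_weight kmin kmax (l + n) +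
     (\<Sum>i<n. run_weight kmin kmax (l + i) * string_sum kmin kmax (n - Suc i))"
proof (induction n arbitrary: l)
  case 0
  then show ?case by (simp add: string_weight_replicate)
next
  case (Suc n)
  have "(\<Sum>s | length s = n. string_weight kmin kmax (replicate l True @ True # s)) =
      (\<Sum>s | length s = n. string_weight kmin kmax (replicate (Suc l) True @ s))"
    by (simp add: replicate_app_Cons_same)
  moreover have "(\<Sum>s | length s = n. string_weight kmin kmax (replicate l True @ False # s)) =
      run_weight kmin kmax l * string_sum kmin kmax n"
    by (simp add: string_weight_block string_sum_def sum_distrib_left)
  ultimately show ?case
    unfolding sum_strings_Suc
    by (simp only: Suc.IH) (simp add: sum.lessThan_Suc_shift add_ac del: sum.lessThan_Suc)
qed

text \<open>
  The two sums differ only by grouping: the coefficient collects the strings by their pair of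
  statistics, and only the finitely many pairs that occur contribute.
\<close>

lemma gen_fun_coeff_string_sum: "gen_fun_coeff kmin kmax (int n) = string_sum kmin kmax n"
proof -
  define S where "S = {s :: bool list. length s = n}"
  define g where "g = (\<lambda>s. (int (num_runs kmin kmax s), int (hamming_weight s)))"
  define h :: "int \<times> int \<Rightarrow> int poly poly" where "h = (\<lambda>(m, r). Y ^ nat m * Z ^ nat r)"
  have S: "finite S" by (simp add: S_def finite_strings)
  have w: "w kmin kmax (int n) m r = card {s \<in> S. g s = (m, r)}" for m r
  proof (cases "m < 0 \<or> r < 0")
    case True
    then have empty: "{s \<in> S. g s = (m, r)} = {}" by (auto simp: g_def)
    from True have "w kmin kmax (int n) m r = 0" by (simp only: w_def if_True disj_assoc simp_thms)
    then show ?thesis by (simp only: empty card.empty)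
  next
    case False
    then have "w kmin kmax (int n) m r = card {s. int (length s) = int n \<and>
        int (hamming_weight s) = r \<and> int (num_runs kmin kmax s) = m}"
      by (simp add: w_def)
    also have "\<dots> = card {s \<in> S. g s = (m, r)}"
      by (rule arg_cong[of _ _ card]) (auto simp: g_def S_def)
    finally show ?thesis .
  qed
  have "gen_fun_coeff kmin kmax (int n) =
      (\<Sum>p. of_nat (card {s \<in> S. g s = p}) * h p)"
    unfolding gen_fun_coeff_def w h_def by (rule Sum_any.cong) (auto simp: mult.assoc)
  also have "\<dots> = (\<Sum>p\<in>g ` S. of_nat (card {s \<in> S. g s = p}) * h p)"
  proof (rule Sum_any.expand_superset)
    have empty: "{s \<in> S. g s = p} = {}" if "p \<notin> g ` S" for p
      using that by auto
    then have "of_nat (card {s \<in> S. g s = p}) * h p = 0" if "p \<notin> g ` S" for p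
      by (simp only: empty[OF that] card.empty of_nat_0 mult_zero_left)
    then show "{p. of_nat (card {s \<in> S. g s = p}) * h p \<noteq> 0} \<subseteq> g ` S"
      by blast
  qed (simp add: S)
  also have "\<dots> = (\<Sum>p\<in>g ` S. \<Sum>s\<in>{s \<in> S. g s = p}. h (g s))"
  proof (rule sum.cong[OF refl])
    fix p
    have "(\<Sum>s\<in>{s \<in> S. g s = p}. h (g s)) = (\<Sum>s\<in>{s \<in> S. g s = p}. h p)"
      by (rule sum.cong) auto
    then show "of_nat (card {s \<in> S. g s = p}) * h p = (\<Sum>s\<in>{s \<in> S. g s = p}. h (g s))"
      by (simp only: sum_constant)
  qed
  also have "\<dots> = (\<Sum>s\<in>S. h (g s))"
    by (rule sum.image_gen[symmetric]) (rule S)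
  finally show ?thesis
    by (simp add: string_sum_def string_weight_def S_def g_def h_def)
qed

lemma gen_fun_coeff_minus_one: "gen_fun_coeff kmin kmax (- 1) = 1"
proof -
  have "gen_fun_coeff kmin kmax (- 1) =
      (\<Sum>p :: int \<times> int. if p = (0, 0) then 1 else 0)"
    unfolding gen_fun_coeff_def
  proof (rule Sum_any.cong)
    fix p :: "int \<times> int"
    obtain m r where p: "p = (m, r)" by (cases p)
    have "w kmin kmax (- 1) m r = of_bool (m = 0 \<and> r = 0)"
      unfolding w_def by simp
    then show "(case p of (m, r) \<Rightarrow> of_nat (w kmin kmax (- 1) m r) * Y ^ nat m * Z ^ nat r) =
        (if p = (0, 0) then 1 else 0)"
      by (simp add: p)
  qed
  then show ?thesis by simp
qed

section \<open>Power series\<close>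

text \<open>
  The index counts the virtual final zero too, so strings of length \<open>n\<close> sit at \<open>n + 1\<close>; the constant
  term is the empty sequence of blocks, which is the convention for length \<open>-1\<close>.
\<close>

definition string_fps :: "nat \<Rightarrow> nat \<Rightarrow> int poly poly fps" where
  "string_fps kmin kmax = Abs_fps (\<lambda>n. case n of 0 \<Rightarrow> 1 | Suc k \<Rightarrow> string_sum kmin kmax k)"

definition block_fps :: "nat \<Rightarrow> nat \<Rightarrow> int poly poly fps" where
  "block_fps kmin kmax = Abs_fps (run_weight kmin kmax)"

lemma string_fps_eq:
  "string_fps kmin kmax = 1 + fps_X * (block_fps kmin kmax * string_fps kmin kmax)"
proof (rule fps_ext)
  fix n
  show "fps_nth (string_fps kmin kmax) n =
      fps_nth (1 + fps_X * (block_fps kmin kmax * string_fps kmin kmax)) n"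
  proof (cases n)
    case 0
    then show ?thesis by (simp add: string_fps_def)
  next
    case (Suc k)
    have "fps_nth (block_fps kmin kmax * string_fps kmin kmax) k =
        (\<Sum>i\<le>k. run_weight kmin kmax i * fps_nth (string_fps kmin kmax) (k - i))"
      by (simp add: fps_mult_nth block_fps_def atLeast0AtMost)
    also have "\<dots> = run_weight kmin kmax k +
        (\<Sum>i<k. run_weight kmin kmax i * fps_nth (string_fps kmin kmax) (k - i))"
      by (simp add: lessThan_Suc_atMost[symmetric] string_fps_def)
    also have "(\<Sum>i<k. run_weight kmin kmax i * fps_nth (string_fps kmin kmax) (k - i)) =
        (\<Sum>i<k. run_weight kmin kmax i * string_sum kmin kmax (k - Suc i))"
    proof (intro sum.cong refl)
      fix i assume "i \<in> {..<k}"
      then have "i < k" by simp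
      show "run_weight kmin kmax i * fps_nth (string_fps kmin kmax) (k - i) =
          run_weight kmin kmax i * string_sum kmin kmax (k - Suc i)"
        unfolding Suc_diff_Suc[OF \<open>i < k\<close>, symmetric]
        by (simp only: string_fps_def fps_nth_Abs_fps nat.case)
    qed
    also have "run_weight kmin kmax k + \<dots> = string_sum kmin kmax k"
      using sum_strings_prefix[of kmin kmax 0 k] by (simp add: string_sum_def)
    finally show ?thesis using Suc by (simp add: string_fps_def)
  qed
qed

text \<open>
  Multiplication by \<open>1 - x z\<close> turns the coefficient \<open>c\<^sub>n z\<^sup>n\<close> into \<open>(c\<^sub>n - c\<^bsub>n-1\<^esub>) z\<^sup>n\<close>, which vanishes
  except where \<open>n\<close> enters or leaves the interval of prescribed lengths, and at \<open>n = 0\<close>.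
\<close>

lemma block_fps_closed_form:
  assumes "kmin \<le> kmax"
  shows "(1 - fps_X * fps_const Z) * block_fps kmin kmax =
    1 - (1 - fps_const Y) *
      (fps_X ^ kmin * fps_const Z ^ kmin - fps_X ^ (kmax + 1) * fps_const Z ^ (kmax + 1))"
    (is "?L = ?R")
proof (rule fps_ext)
  fix n
  have R: "?R = 1 - fps_const (1 - Y) *
      (fps_X ^ kmin * fps_const (Z ^ kmin) - fps_X ^ (kmax + 1) * fps_const (Z ^ (kmax + 1)))"
    by (simp add: fps_const_power fps_const_sub[symmetric] del: fps_const_sub)
  have "?L = block_fps kmin kmax - fps_X * (fps_const Z * block_fps kmin kmax)"
    by (simp only: left_diff_distrib mult_1 mult.assoc)
  then have "fps_nth ?L n = run_weight kmin kmax n -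
      (if n = 0 then 0 else Z * run_weight kmin kmax (n - 1))"
    by (simp add: block_fps_def)
  also have "\<dots> = of_bool (n = 0) -
      (1 - Y) * (of_bool (n = kmin) * Z ^ kmin - of_bool (n = kmax + 1) * Z ^ (kmax + 1))"
  proof (cases n)
    case (Suc k)
    consider "n = kmin" | "n = kmax + 1" | "n \<noteq> kmin" "n \<noteq> kmax + 1" by blast
    then show ?thesis
      using assms Suc by cases (auto simp: run_weight_def algebra_simps)
  qed (use assms in \<open>auto simp: run_weight_def algebra_simps\<close>)
  also have "\<dots> = fps_nth ?R n"
    unfolding R by (simp del: fps_const_sub power_Suc)
  finally show "fps_nth ?L n = fps_nth ?R n" .
qed

definition denom_fps :: "nat \<Rightarrow> nat \<Rightarrow> int poly poly fps" where
  "denom_fps kmin kmax = 1 - fps_X * (fps_const Z + 1) + (1 - fps_const Y) *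
     (fps_X ^ (kmin + 1) * fps_const Z ^ kmin - fps_X ^ (kmax + 2) * fps_const Z ^ (kmax + 1))"

lemma string_fps_times_denom:
  assumes "kmin \<le> kmax"
  shows "string_fps kmin kmax * denom_fps kmin kmax = 1 - fps_X * fps_const Z"
proof -
  let ?A = "string_fps kmin kmax" and ?C = "block_fps kmin kmax" and ?Z = "fps_const Z"
  have "denom_fps kmin kmax = 1 - fps_X * ?Z - fps_X * ((1 - fps_X * ?Z) * ?C)"
    unfolding block_fps_closed_form[OF assms] denom_fps_def by (simp add: algebra_simps)
  then have "?A * denom_fps kmin kmax = ?A * (1 - fps_X * ?Z - fps_X * ((1 - fps_X * ?Z) * ?C))"
    by (rule arg_cong)
  also have "\<dots> = (1 - fps_X * ?Z) * (?A - fps_X * (?C * ?A))"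
    by (simp add: algebra_simps)
  also have "?A - fps_X * (?C * ?A) = 1"
    using string_fps_eq[of kmin kmax] by (metis add_diff_cancel_right')
  finally show ?thesis by simp
qed

lemma denom_fps_dvd_1: "denom_fps kmin kmax dvd 1"
proof -
  have "fps_nth (denom_fps kmin kmax) 0 = 1"
    by (simp add: denom_fps_def)
  then have "fps_left_inverse (denom_fps kmin kmax) 1 * denom_fps kmin kmax = 1"
    by (intro fps_left_inverse) simp
  then show ?thesis by (metis dvd_triv_right)
qed

section \<open>The Laurent series\<close>

lemma fls_X_times_gen_fun: "fls_X * gen_fun kmin kmax = fps_to_fls (string_fps kmin kmax)"
proof (rule fls_eqI)
  fix n :: int
  have "gen_fun_coeff kmin kmax (n - 1) =
      (if n < 0 then 0 else fps_nth (string_fps kmin kmax) (nat n))"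
  proof (cases "n \<le> 0")
    case True
    then show ?thesis
      by (cases "n = 0")
        (simp_all add: gen_fun_coeff_minus_one string_fps_def,
          simp add: gen_fun_coeff_def w_def)
  next
    case False
    then obtain k where "n = int (Suc k)"
      by (metis gr0_implies_Suc not_le zero_less_imp_eq_int)
    then show ?thesis
      by (simp add: string_fps_def gen_fun_coeff_string_sum nat_add_distrib)
  qed
  then show "fls_nth (fls_X * gen_fun kmin kmax) n = fls_nth (fps_to_fls (string_fps kmin kmax)) n"
    by (simp add: fls_X_times_conv_shift gen_fun_nth)
qed

theorem mainTheorem13:
  fixes kmin kmax :: nat
  assumes "kmin \<le> kmax"
  shows "let x = fls_X; y = fls_const Y; z = fls_const Z in
    is_fraction (gen_fun kmin kmax)
      (1 - x * z)
      (x * (1 - x * (z + 1)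
            + (1 - y) * (x ^ (kmin + 1) * z ^ kmin - x ^ (kmax + 2) * z ^ (kmax + 1))))"
proof -
  let ?x = "fls_X :: int poly poly fls" and ?y = "fls_const Y" and ?z = "fls_const Z"
  let ?D = "1 - ?x * (?z + 1)
    + (1 - ?y) * (?x ^ (kmin + 1) * ?z ^ kmin - ?x ^ (kmax + 2) * ?z ^ (kmax + 1))"
  have D: "?D = fps_to_fls (denom_fps kmin kmax)"
    by (simp add: denom_fps_def fls_times_fps_to_fls fps_to_fls_power
        del: power_Suc fps_const_power fps_const_add fps_const_sub)
  have "?x dvd 1"
    by (rule dvdI[of _ _ fls_X_inv]) (simp add: fls_X_times_conv_shift)
  moreover have "?D dvd 1"
  proof -
    obtain e where "1 = denom_fps kmin kmax * e"
      using denom_fps_dvd_1 by (rule dvdE)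
    then have "1 = ?D * fps_to_fls e"
      unfolding D by (metis fls_times_fps_to_fls fps_one_to_fls)
    then show ?thesis by (rule dvdI)
  qed
  ultimately have unit: "?x * ?D dvd 1"
    using mult_dvd_mono[of ?x 1 ?D 1] by simp
  have "gen_fun kmin kmax * (?x * ?D) = fps_to_fls (string_fps kmin kmax * denom_fps kmin kmax)"
    unfolding D fls_times_fps_to_fls fls_X_times_gen_fun[symmetric] by (simp only: mult_ac)
  also have "\<dots> = 1 - ?x * ?z"
    unfolding string_fps_times_denom[OF assms] by (simp add: fls_times_fps_to_fls)
  finally show ?thesis
    unfolding Let_def is_fraction_def using unit by blast
qed

end
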